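(* Let $\lambda>0$ and $\Omega_\lambda=\{x\in\mathbb{R}^2:\ \|x\|<1/\lambda\}$. Let $d_F$ be the distance (traveling time) induced by the $\lambda$-Funk metric $F$ on $\Omega_\lambda$. Given $P,Q\in\Omega_\lambda$ with $P\ne Q$, $$d_F(P,Q)=\frac1\lambda\ln\left(\frac{\sqrt{\lambda^2\langle P,Q-P\rangle^2+(1-\lambda^2\|P\|^2)\|Q-P\|^2}-\lambda\langle P,Q-P\rangle}{\sqrt{\lambda^2\langle P,Q-P\rangle^2+(1-\lambda^2\|P\|^2)\|Q-P\|^2}-\lambda\langle Q,Q-P\rangle}\right),$$ and $d_F(P,P)=0$.
   Context: $\langle\cdot,\cdot\rangle$ and $\|\cdot\|$ denote the usual Euclidean inner product and norm on $\mathbb{R}^2$. For $\lambda>0$ the $\lambda$-Funk metric is the function $F:\Omega_\lambda\times\mathbb{R}^2\to\mathbb{R}$, $$F(x,y)=\frac{\sqrt{\lambda^2\langle x,y\rangle^2+\|y\|^2(1-\lambda^2\|x\|^2)}}{1-\lambda^2\|x\|^2}+\frac{\lambda\langle x,y\rangle}{1-\lambda^2\|x\|^2}.$$ For a piecewise regular curve $c:[\alpha,\beta]\to\Omega_\lambda$, its Finsler arc length is $\mathscr{L}_F(c)=\int_\alpha^\beta F(c(t),c'(t))\,dt$. The induced distance from $P$ to $Q$ is $d_F(P,Q)=\inf_c\mathscr{L}_F(c)$, the infimum being taken over all piecewise regular curves $c:[\alpha,\beta]\to\Omega_\lambda$ with $c(\alpha)=P$ and $c(\beta)=Q$; by convention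 $d_F(P,P)=0$. Note that $d_F$ need not be symmetric. *)

theory Defs
  imports "HOL-Analysis.Analysis"
begin

definition Omega :: "real \<Rightarrow> (real^2) set" where
  "Omega lam = {x. norm x < 1 / lam}"

text \<open>Only used for base points \<open>x \<in> Omega lam\<close>, where both denominators are positive.\<close>

definition funk_metric :: "real \<Rightarrow> real^2 \<Rightarrow> real^2 \<Rightarrow> real" where
  "funk_metric lam x y =
     sqrt (lam\<^sup>2 * (x \<bullet> y)\<^sup>2 + (norm y)\<^sup>2 * (1 - lam\<^sup>2 * (norm x)\<^sup>2)) / (1 - lam\<^sup>2 * (norm x)\<^sup>2)
     + lam * (x \<bullet> y) / (1 - lam\<^sup>2 * (norm x)\<^sup>2)"

text \<open>Derivatives are taken within the closed interval, so they are one-sided at the endpoints.\<close>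

definition regular_curve_on :: "real \<Rightarrow> real \<Rightarrow> (real \<Rightarrow> real^2) \<Rightarrow> bool" where
  "regular_curve_on a b c \<longleftrightarrow>
     (\<exists>D. continuous_on {a..b} D \<and>
          (\<forall>t\<in>{a..b}. (c has_vector_derivative D t) (at t within {a..b}) \<and> D t \<noteq> 0))"

text \<open>
  Unlike for \<^const>\<open>piecewise_C1_differentiable_on\<close>, the derivative has nonzero one-sided
  limits at the breakpoints \<open>\<tau> i\<close>.
\<close>

definition piecewise_regular_curve :: "real \<Rightarrow> real \<Rightarrow> (real \<Rightarrow> real^2) \<Rightarrow> bool" where
  "piecewise_regular_curve a b c \<longleftrightarrow>
     a < b \<and> continuous_on {a..b} c \<and>
     (\<exists>n (\<tau> :: nat \<Rightarrow> real). \<tau> 0 = a \<and> \<tau> n = b \<and>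
        (\<forall>i<n. \<tau> i < \<tau> (Suc i) \<and> regular_curve_on (\<tau> i) (\<tau> (Suc i)) c))"

text \<open>The integrand is unspecified at the finitely many corners, which does not affect the integral.\<close>

definition finsler_length :: "(real^2 \<Rightarrow> real^2 \<Rightarrow> real) \<Rightarrow> real \<Rightarrow> real \<Rightarrow> (real \<Rightarrow> real^2) \<Rightarrow> real" where
  "finsler_length F a b c =
     integral {a..b} (\<lambda>t. F (c t) (vector_derivative c (at t within {a..b})))"

definition finsler_dist ::
    "(real^2) set \<Rightarrow> (real^2 \<Rightarrow> real^2 \<Rightarrow> real) \<Rightarrow> real^2 \<Rightarrow> real^2 \<Rightarrow> real" where
  "finsler_dist U F P Q =
     (if P = Q then 0
      else Inf {finsler_length F a b c | a b c.
                  piecewise_regular_curve a b c \<and> c ` {a..b} \<subseteq> U \<and> c a = P \<and> c b = Q})"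

end

theory Submission
  imports Defs
begin

text \<open>
  The Funk metric is determined by a boundary point: \<open>f = F(x,y)\<close> is the solution
  \<open>f \<ge> 0\<close> of \<open>\<parallel>y + \<lambda> f x\<parallel> = f\<close>, which for \<open>y \<noteq> 0\<close> means that \<open>x + y / (\<lambda> f)\<close> is the point
  where the ray from \<open>x\<close> in direction \<open>y\<close> leaves the disc (\<open>norm_add_funk_metric\<close> and
  \<open>funk_metric_eqI\<close>).

  Pairing \<open>y + \<lambda> F(x,y) x\<close> with a unit vector \<open>u\<close> and using Cauchy--Schwarz gives
  \<open>\<langle>y,u\<rangle> / (1 - \<lambda> \<langle>x,u\<rangle>) \<le> F(x,y)\<close>. The left-hand side is the differential at \<open>x\<close>, applied to
  \<open>y\<close>, of the potential \<open>\<phi>(x) = - ln (1 - \<lambda> \<langle>x,u\<rangle>) / \<lambda>\<close>, so every curve from \<open>P\<close> to \<open>Q\<close>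
  has length at least \<open>\<phi>(Q) - \<phi>(P)\<close> (\<open>finsler_length_ge_potential\<close>), whatever \<open>u\<close> is.

  The right choice of \<open>u\<close> is the unit normal of the circle at the point \<open>P + s (Q - P)\<close>, \<open>s > 1\<close>,
  where the ray from \<open>P\<close> through \<open>Q\<close> leaves the disc. It turns the bound into
  \<open>ln (s / (s - 1)) / \<lambda>\<close>. Along the segment all tangent rays leave the disc at that same point,
  so \<open>F(P + t (Q - P), Q - P) = 1 / (\<lambda> (s - t))\<close>, and integrating shows that the segment attains
  the bound. Solving the quadratic equation for \<open>s\<close> gives the stated formula.
\<close>

section \<open>The Funk metric and the boundary circle\<close>

lemma mem_Omega_iff:
  assumes "lam > 0"
  shows "x \<in> Omega lam \<longleftrightarrow> lam * norm x < 1"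
  using assms by (simp add: Omega_def field_simps)

lemma funk_denominator_pos:
  assumes "lam > 0" and "x \<in> Omega lam"
  shows "1 - lam\<^sup>2 * (norm x)\<^sup>2 > 0"
proof -
  have "(lam * norm x)\<^sup>2 < 1"
    using assms by (simp add: mem_Omega_iff power_less_one_iff abs_square_less_1)
  then show ?thesis by (simp add: power_mult_distrib)
qed

lemma inner_unit_less_one:
  assumes "lam > 0" and "x \<in> Omega lam" and "norm u = 1"
  shows "lam * (x \<bullet> u) < 1"
proof -
  have "x \<bullet> u \<le> norm x"
    using norm_cauchy_schwarz[of x u] assms(3) by simp
  then have "lam * (x \<bullet> u) \<le> lam * norm x"
    using assms(1) by simp
  then show ?thesis
    using assms mem_Omega_iff[of lam x] by linarith
qed

lemma norm_add_scaled_sq: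
  fixes x y :: "'a::real_inner"
  shows "(norm (y + r *\<^sub>R x))\<^sup>2 = (norm y)\<^sup>2 + 2 * r * (x \<bullet> y) + r\<^sup>2 * (norm x)\<^sup>2"
  unfolding power2_norm_eq_inner
  by (simp add: inner_add_left inner_add_right inner_commute power2_eq_square algebra_simps)

text \<open>
  The Funk metric is a root of \<open>A f\<^sup>2 - 2 k f = \<parallel>y\<parallel>\<^sup>2\<close> with \<open>A = 1 - \<lambda>\<^sup>2 \<parallel>x\<parallel>\<^sup>2\<close> and
  \<open>k = \<lambda> \<langle>x,y\<rangle>\<close>, and this equation is \<open>\<parallel>y + \<lambda> f x\<parallel>\<^sup>2 = f\<^sup>2\<close>.
\<close>

lemma norm_add_funk_metric:
  assumes "lam > 0" and "x \<in> Omega lam"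
  shows "funk_metric lam x y \<ge> 0"
    and "norm (y + (lam * funk_metric lam x y) *\<^sub>R x) = funk_metric lam x y"
proof -
  define A where "A = 1 - lam\<^sup>2 * (norm x)\<^sup>2"
  define k where "k = lam * (x \<bullet> y)"
  define S where "S = sqrt (k\<^sup>2 + (norm y)\<^sup>2 * A)"
  define f where "f = funk_metric lam x y"
  have A: "A > 0"
    using funk_denominator_pos[OF assms] by (simp add: A_def)
  have f: "f = (S + k) / A"
    by (simp add: f_def funk_metric_def S_def A_def k_def power_mult_distrib add_divide_distrib)
  have S2: "S\<^sup>2 = k\<^sup>2 + (norm y)\<^sup>2 * A"
    using A by (simp add: S_def)
  have "\<bar>k\<bar> \<le> S"
    using A by (simp add: S_def real_le_rsqrt)
  then have f0: "f \<ge> 0"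
    using A by (simp add: f)
  have Af: "A * f = S + k"
    using A by (simp add: f)
  have "A * (A * f\<^sup>2 - 2 * k * f) = (A * f)\<^sup>2 - 2 * k * (A * f)"
    by (simp add: power2_eq_square algebra_simps)
  also have "\<dots> = A * (norm y)\<^sup>2"
    using S2 by (simp add: Af power2_eq_square algebra_simps)
  finally have "A * f\<^sup>2 - 2 * k * f = (norm y)\<^sup>2"
    using A by simp
  then have "(norm (y + (lam * f) *\<^sub>R x))\<^sup>2 = f\<^sup>2"
    by (simp add: norm_add_scaled_sq A_def k_def power_mult_distrib algebra_simps)
  then have "norm (y + (lam * f) *\<^sub>R x) = f"
    using f0 by (simp add: power2_eq_iff_nonneg)
  then show "funk_metric lam x y \<ge> 0"
    and "norm (y + (lam * funk_metric lam x y) *\<^sub>R x) = funk_metric lam x y"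
    using f0 by (simp_all add: f_def)
qed

text \<open>
  The other root of the quadratic equation satisfies \<open>A f = k - S \<le> 0\<close>, with \<open>S\<close> the square
  root in the formula for the metric; a positive \<open>f\<close> therefore has to be the Funk metric.
\<close>

lemma funk_metric_eqI:
  assumes "lam > 0" and "x \<in> Omega lam" and "f > 0"
    and "norm (y + (lam * f) *\<^sub>R x) = f"
  shows "funk_metric lam x y = f"
proof -
  define A where "A = 1 - lam\<^sup>2 * (norm x)\<^sup>2"
  define k where "k = lam * (x \<bullet> y)"
  have A: "A > 0"
    using funk_denominator_pos[OF assms(1,2)] by (simp add: A_def)
  have "f\<^sup>2 = (norm y)\<^sup>2 + 2 * (lam * f) * (x \<bullet> y) + (lam * f)\<^sup>2 * (norm x)\<^sup>2"
    using norm_add_scaled_sq[of y "lam * f" x] assms(4) by simp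
  then have y: "(norm y)\<^sup>2 = f * (A * f - 2 * k)"
    by (simp add: A_def k_def power2_eq_square algebra_simps)
  then have "A * f - 2 * k \<ge> 0"
    using assms(3) by (metis zero_le_mult_iff zero_le_power2 not_less)
  moreover have "A * f > 0"
    using A assms(3) by simp
  ultimately have nonneg: "A * f - k \<ge> 0"
    by linarith
  have "k\<^sup>2 + (norm y)\<^sup>2 * A = (A * f - k)\<^sup>2"
    unfolding y by (simp add: power2_eq_square algebra_simps)
  then have "sqrt (k\<^sup>2 + (norm y)\<^sup>2 * A) = A * f - k"
    using nonneg by simp
  then have "funk_metric lam x y = (A * f - k) / A + k / A"
    by (simp add: funk_metric_def A_def k_def power_mult_distrib)
  then show ?thesis
    using A by (simp add: diff_divide_distrib)
qed

text \<open>
  Geometrically, the closed unit ball of \<open>F(x,\<cdot>)\<close> is the closed disc of radius \<open>1/\<lambda>\<close> seen from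
  \<open>x\<close> and scaled by \<open>\<lambda>\<close>; the bound is what the half-plane touching the disc at \<open>u / \<lambda>\<close> gives.
\<close>

lemma funk_metric_ge_supporting:
  assumes "lam > 0" and "x \<in> Omega lam" and "norm u = 1"
  shows "(y \<bullet> u) / (1 - lam * (x \<bullet> u)) \<le> funk_metric lam x y"
proof -
  let ?F = "funk_metric lam x y"
  have "(y + (lam * ?F) *\<^sub>R x) \<bullet> u \<le> ?F"
    using norm_cauchy_schwarz[of "y + (lam * ?F) *\<^sub>R x" u]
      norm_add_funk_metric(2)[OF assms(1,2), of y] assms(3) by simp
  then have "y \<bullet> u \<le> ?F * (1 - lam * (x \<bullet> u))"
    by (simp add: inner_add_left algebra_simps)
  then show ?thesis
    using inner_unit_less_one[OF assms] by (simp add: pos_divide_le_eq)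
qed

lemma continuous_on_funk_metric:
  assumes "lam > 0"
  shows "continuous_on (Omega lam \<times> UNIV) (\<lambda>(x, y). funk_metric lam x y)"
proof -
  have "1 - lam\<^sup>2 * (norm (fst p))\<^sup>2 \<noteq> 0" if "p \<in> Omega lam \<times> UNIV" for p :: "(real^2) \<times> (real^2)"
    using funk_denominator_pos[OF assms, of "fst p"] that by auto
  then show ?thesis
    unfolding funk_metric_def case_prod_unfold by (intro continuous_intros) auto
qed


section \<open>Lengths of curves and potentials\<close>

text \<open>
  The lower bound on one smooth piece \<open>[p, q]\<close> of a curve on \<open>[a, b]\<close>. Integrability is part of
  the conclusion because the Henstock--Kurzweil integral of a non-integrable function is 0,
  which need not be bounded below by the increase of the potential.
\<close>

lemma potential_le_integral_piece:
  fixes \<phi> :: "real^2 \<Rightarrow> real"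
  assumes F: "continuous_on (U \<times> UNIV) (\<lambda>(x, y). F x y)"
    and \<phi>: "\<And>x. x \<in> U \<Longrightarrow> (\<phi> has_derivative \<phi>' x) (at x)"
    and le: "\<And>x y. x \<in> U \<Longrightarrow> \<phi>' x y \<le> F x y"
    and c: "regular_curve_on p q c" and U: "c ` {p..q} \<subseteq> U"
    and ord: "a \<le> p" "p < q" "q \<le> b"
  defines "g \<equiv> \<lambda>t. F (c t) (vector_derivative c (at t within {a..b}))"
  shows "g integrable_on {p..q}" and "\<phi> (c q) - \<phi> (c p) \<le> integral {p..q} g"
proof -
  obtain D where D: "continuous_on {p..q} D"
    and dc: "\<And>t. t \<in> {p..q} \<Longrightarrow> (c has_vector_derivative D t) (at t within {p..q})"
    using c unfolding regular_curve_on_def by blast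
  have "continuous_on {p..q} c"
    using dc has_vector_derivative_continuous continuous_on_eq_continuous_within by blast
  then have "continuous_on {p..q} (\<lambda>t. (c t, D t))"
    using D by (intro continuous_intros)
  then have "continuous_on {p..q} (\<lambda>t. (\<lambda>(x, y). F x y) (c t, D t))"
    by (rule continuous_on_compose2[OF F]) (use U in auto)
  then have "continuous_on {p..q} (\<lambda>t. F (c t) (D t))"
    by simp
  then have "(\<lambda>t. F (c t) (D t)) integrable_on {p..q}"
    by (rule integrable_continuous_interval)
  then have FD: "((\<lambda>t. F (c t) (D t)) has_integral integral {p..q} (\<lambda>t. F (c t) (D t))) {p..q}"
    by (rule integrable_integral)
  \<comment> \<open>Off \<open>{p, q}\<close> the derivatives within the piece and within \<open>[a, b]\<close> are both two-sided.\<close>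
  have D_eq: "g t = F (c t) (D t)" if "t \<in> {p..q} - {p, q}" for t
  proof -
    have t: "t \<in> {p<..<q}" "t \<in> {a<..<b}"
      using that ord by auto
    have "(c has_vector_derivative D t) (at t)"
      using dc[of t] t at_within_Icc_at[of p t q] by auto
    then show ?thesis
      using t at_within_Icc_at[of a t b] by (simp add: g_def vector_derivative_at)
  qed
  have g: "(g has_integral integral {p..q} (\<lambda>t. F (c t) (D t))) {p..q}"
    by (rule has_integral_spike_finite[OF _ _ FD, of "{p, q}"]) (use D_eq in auto)
  have "((\<lambda>t. \<phi>' (c t) (D t)) has_integral (\<phi> (c q) - \<phi> (c p))) {p..q}"
  proof (rule fundamental_theorem_of_calculus)
    fix t assume t: "t \<in> {p..q}"
    then have ct: "c t \<in> U"
      using U by auto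
    have "(\<phi> \<circ> c has_derivative \<phi>' (c t) \<circ> (\<lambda>h. h *\<^sub>R D t)) (at t within {p..q})"
      using diff_chain_within[OF dc[OF t, unfolded has_vector_derivative_def]
          has_derivative_at_withinI[OF \<phi>[OF ct]]] .
    moreover have "linear (\<phi>' (c t))"
      using \<phi>[OF ct] has_derivative_linear by blast
    ultimately show "((\<lambda>t. \<phi> (c t)) has_vector_derivative \<phi>' (c t) (D t)) (at t within {p..q})"
      by (simp add: has_vector_derivative_def o_def linear_cmul)
  qed (use ord in simp)
  then have "\<phi> (c q) - \<phi> (c p) \<le> integral {p..q} (\<lambda>t. F (c t) (D t))"
    by (rule has_integral_le[OF _ FD]) (use U in \<open>auto intro!: le\<close>)
  then show "g integrable_on {p..q}" and "\<phi> (c q) - \<phi> (c p) \<le> integral {p..q} g"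
    using g by (auto simp: integral_unique has_integral_integrable)
qed

text \<open>
  A calibration argument: if \<open>F\<close> dominates the differential of \<open>\<phi>\<close>, then the length of a curve
  dominates the increase of \<open>\<phi>\<close> along it, by the fundamental theorem of calculus on each smooth
  piece. Continuity of \<open>F\<close> makes its integral over each piece exist.
\<close>

theorem finsler_length_ge_potential:
  assumes F: "continuous_on (U \<times> UNIV) (\<lambda>(x, y). F x y)"
    and \<phi>: "\<And>x. x \<in> U \<Longrightarrow> (\<phi> has_derivative \<phi>' x) (at x)"
    and le: "\<And>x y. x \<in> U \<Longrightarrow> \<phi>' x y \<le> F x y"
    and c: "piecewise_regular_curve a b c" and U: "c ` {a..b} \<subseteq> U"
  shows "\<phi> (c b) - \<phi> (c a) \<le> finsler_length F a b c"
proof -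
  let ?g = "\<lambda>t. F (c t) (vector_derivative c (at t within {a..b}))"
  obtain n and \<tau> :: "nat \<Rightarrow> real" where \<tau>0: "\<tau> 0 = a" and \<tau>n: "\<tau> n = b"
    and less: "\<And>i. i < n \<Longrightarrow> \<tau> i < \<tau> (Suc i)"
    and reg: "\<And>i. i < n \<Longrightarrow> regular_curve_on (\<tau> i) (\<tau> (Suc i)) c"
    using c unfolding piecewise_regular_curve_def by blast
  have mono: "\<tau> i \<le> \<tau> j" if "i \<le> j" "j \<le> n" for i j
    using that
  proof (induction j rule: dec_induct)
    case (step j)
    then show ?case using less[of j] by fastforce
  qed simp
  have "?g integrable_on {a..\<tau> m} \<and> \<phi> (c (\<tau> m)) - \<phi> (c a) \<le> integral {a..\<tau> m} ?g"
    if "m \<le> n" for m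
    using that
  proof (induction m)
    case 0
    show ?case using integrable_on_refl[of ?g a] by (simp add: \<tau>0)
  next
    case (Suc m)
    then have m: "m < n" and IH: "?g integrable_on {a..\<tau> m}"
      "\<phi> (c (\<tau> m)) - \<phi> (c a) \<le> integral {a..\<tau> m} ?g"
      by auto
    have ord: "a \<le> \<tau> m" "\<tau> m < \<tau> (Suc m)" "\<tau> (Suc m) \<le> b"
      using mono[of 0 m] mono[of "Suc m" n] m less[OF m] \<tau>0 \<tau>n by auto
    have "c ` {\<tau> m..\<tau> (Suc m)} \<subseteq> U"
      using U ord by fastforce
    note piece = potential_le_integral_piece[OF F \<phi> le reg[OF m] this ord]
    have "?g integrable_on {a..\<tau> (Suc m)}"
      using Henstock_Kurzweil_Integration.integrable_combine[OF _ _ IH(1) piece(1)] ord by simp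
    moreover from this have
      "integral {a..\<tau> m} ?g + integral {\<tau> m..\<tau> (Suc m)} ?g = integral {a..\<tau> (Suc m)} ?g"
      using Henstock_Kurzweil_Integration.integral_combine[of a "\<tau> m" "\<tau> (Suc m)" ?g] ord by simp
    ultimately show ?case
      using IH(2) piece(2) by linarith
  qed
  from this[of n] show ?thesis
    by (simp add: finsler_length_def \<tau>n)
qed

lemma funk_length_ge_supporting:
  assumes "lam > 0" and "norm u = 1"
    and c: "piecewise_regular_curve a b c" and \<Omega>: "c ` {a..b} \<subseteq> Omega lam"
  shows "finsler_length (funk_metric lam) a b c
    \<ge> 1 / lam * ln ((1 - lam * (c a \<bullet> u)) / (1 - lam * (c b \<bullet> u)))"
proof -
  define \<phi> where "\<phi> = (\<lambda>x. - ln (1 - lam * (x \<bullet> u)) / lam)"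
  have "(\<phi> has_derivative (\<lambda>y. (y \<bullet> u) / (1 - lam * (x \<bullet> u)))) (at x)" if "x \<in> Omega lam" for x
    unfolding \<phi>_def using inner_unit_less_one[OF assms(1) that assms(2)] assms(1)
    by (auto intro!: derivative_eq_intros simp: divide_simps)
  from finsler_length_ge_potential[OF continuous_on_funk_metric[OF assms(1)] this
      funk_metric_ge_supporting[OF assms(1) _ assms(2)] c \<Omega>]
  have "\<phi> (c b) - \<phi> (c a) \<le> finsler_length (funk_metric lam) a b c" by simp
  moreover have "a \<le> b"
    using c by (simp add: piecewise_regular_curve_def)
  then have "1 - lam * (c a \<bullet> u) > 0" "1 - lam * (c b \<bullet> u) > 0"
    using inner_unit_less_one[OF assms(1) _ assms(2)] \<Omega> by (force simp: image_subset_iff)+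
  then have "\<phi> (c b) - \<phi> (c a) = 1 / lam * ln ((1 - lam * (c a \<bullet> u)) / (1 - lam * (c b \<bullet> u)))"
    unfolding \<phi>_def by (subst ln_div) (simp_all add: diff_divide_distrib)
  ultimately show ?thesis by simp
qed


section \<open>The segment is a shortest curve\<close>

text \<open>
  The parameter \<open>s\<close> is the positive root of the quadratic equation \<open>\<lambda>\<^sup>2 \<parallel>P + s v\<parallel>\<^sup>2 = 1\<close>. It
  exceeds 1 because the value of the left-hand side is still below 1 at \<open>s = 1\<close>, which in terms of
  the discriminant reads \<open>\<lambda> \<langle>P,v\<rangle> + \<lambda> \<parallel>v\<parallel>\<^sup>2 < S\<close>.
\<close>

lemma exit_point:
  fixes P v :: "'a::real_inner"
  assumes lam: "lam > 0" and "v \<noteq> 0" and P: "lam * norm P < 1" and Pv: "lam * norm (P + v) < 1"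
  defines "S \<equiv> sqrt (lam\<^sup>2 * (P \<bullet> v)\<^sup>2 + (1 - lam\<^sup>2 * (norm P)\<^sup>2) * (norm v)\<^sup>2)"
  defines "s \<equiv> (S - lam * (P \<bullet> v)) / (lam * (norm v)\<^sup>2)"
  shows "s > 1" and "lam * norm (P + s *\<^sub>R v) = 1"
proof -
  define A where "A = 1 - lam\<^sup>2 * (norm P)\<^sup>2"
  define k where "k = lam * (P \<bullet> v)"
  define n where "n = (norm v)\<^sup>2"
  have n: "n > 0"
    using assms(2) by (simp add: n_def)
  have "(lam * norm P)\<^sup>2 < 1"
    using P lam by (simp add: abs_square_less_1)
  then have A: "A > 0"
    by (simp add: A_def power_mult_distrib)
  have S: "S = sqrt (k\<^sup>2 + A * n)"
    by (simp add: S_def A_def k_def n_def power_mult_distrib)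
  have S2: "S\<^sup>2 = k\<^sup>2 + A * n"
    using A n by (simp add: S)
  have "(lam * norm (P + v))\<^sup>2 < 1"
    using Pv lam by (simp add: abs_square_less_1)
  then have "2 * lam * k + lam\<^sup>2 * n < A"
    using norm_add_scaled_sq[of P 1 v]
    by (simp add: power_mult_distrib A_def k_def n_def power2_eq_square inner_commute algebra_simps)
  then have "n * (2 * lam * k + lam\<^sup>2 * n) < n * A"
    using n by simp
  then have "(k + lam * n)\<^sup>2 < k\<^sup>2 + A * n"
    by (simp add: power2_eq_square algebra_simps)
  then have "k + lam * n < S"
    by (simp add: S real_less_rsqrt)
  then show s: "s > 1"
    using lam n by (simp add: s_def k_def n_def)
  have sn: "lam * n * s = S - k"
    using lam n by (simp add: s_def k_def n_def)
  have "n * (lam * norm (P + s *\<^sub>R v))\<^sup>2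
      = n * (1 - A) + 2 * k * (lam * n * s) + (lam * n * s)\<^sup>2"
    using norm_add_scaled_sq[of P s v]
    by (simp add: power_mult_distrib A_def k_def n_def power2_eq_square inner_commute algebra_simps)
  also have "\<dots> = n"
    unfolding sn using S2 by (simp add: power2_eq_square algebra_simps)
  finally have "(lam * norm (P + s *\<^sub>R v))\<^sup>2 = 1"
    using n by simp
  moreover have "lam * norm (P + s *\<^sub>R v) \<ge> 0"
    using lam by simp
  ultimately show "lam * norm (P + s *\<^sub>R v) = 1"
    using power2_eq_iff_nonneg[of "lam * norm (P + s *\<^sub>R v)" 1] by simp
qed

lemma segment_in_Omega:
  assumes "lam > 0" and "P \<in> Omega lam" and "P + v \<in> Omega lam" and "t \<in> {0..1}"
  shows "P + t *\<^sub>R v \<in> Omega lam"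
proof -
  have "Omega lam = ball 0 (1 / lam)"
    by (auto simp: Omega_def)
  then have "convex (Omega lam)"
    by simp
  then have "(1 - t) *\<^sub>R P + t *\<^sub>R (P + v) \<in> Omega lam"
    using assms convexD_alt[of "Omega lam" P "P + v" t] by simp
  then show ?thesis
    by (simp add: algebra_simps)
qed

lemma piecewise_regular_segment:
  assumes "v \<noteq> 0"
  shows "piecewise_regular_curve 0 1 (\<lambda>t. P + t *\<^sub>R v)"
proof -
  have "((\<lambda>t. P + t *\<^sub>R v) has_vector_derivative v) (at t within A)" for t A
    by (auto intro!: derivative_eq_intros)
  then have reg: "regular_curve_on 0 1 (\<lambda>t. P + t *\<^sub>R v)"
    unfolding regular_curve_on_def using assms by (intro exI[of _ "\<lambda>_. v"]) auto
  have "continuous_on {0..1} (\<lambda>t. P + t *\<^sub>R v)"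
    by (intro continuous_intros)
  then show ?thesis
    unfolding piecewise_regular_curve_def using reg
    by (intro conjI exI[of _ "1::nat"] exI[of _ real]) auto
qed

lemma funk_length_segment:
  assumes lam: "lam > 0" and P: "P \<in> Omega lam" and Pv: "P + v \<in> Omega lam"
    and s: "s > 1" and exit: "lam * norm (P + s *\<^sub>R v) = 1"
  shows "finsler_length (funk_metric lam) 0 1 (\<lambda>t. P + t *\<^sub>R v) = 1 / lam * ln (s / (s - 1))"
proof -
  let ?c = "\<lambda>t. P + t *\<^sub>R v"
  have F: "funk_metric lam (?c t) (vector_derivative ?c (at t within {0..1})) = 1 / (lam * (s - t))"
    if t: "t \<in> {0..1}" for t
  proof -
    have "(?c has_vector_derivative v) (at t within {0..1})"
      by (auto intro!: derivative_eq_intros)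
    then have vd: "vector_derivative ?c (at t within {0..1}) = v"
      by (rule vector_derivative_within_cbox[of 0 1 t ?c v, simplified, rotated -1]) (use t in auto)
    have st: "s - t > 0"
      using s t by simp
    \<comment> \<open>The metric is read off from the exit point of the tangent ray, the same for every \<open>t\<close>.\<close>
    have "v + (lam * (1 / (lam * (s - t)))) *\<^sub>R ?c t = (1 / (s - t)) *\<^sub>R ((s - t) *\<^sub>R v + ?c t)"
      using lam st by (simp add: scaleR_add_right)
    also have "\<dots> = (1 / (s - t)) *\<^sub>R (P + s *\<^sub>R v)"
      by (simp add: algebra_simps)
    finally have "norm (v + (lam * (1 / (lam * (s - t)))) *\<^sub>R ?c t) = norm (P + s *\<^sub>R v) / (s - t)"
      using st by simp
    also have "norm (P + s *\<^sub>R v) = 1 / lam"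
      using exit lam by (simp add: eq_divide_eq mult.commute)
    finally show ?thesis
      unfolding vd using lam st
      by (intro funk_metric_eqI[OF lam segment_in_Omega[OF lam P Pv t]]) simp_all
  qed
  have "((\<lambda>t. 1 / (lam * (s - t))) has_integral (- ln (s - 1) / lam - (- ln (s - 0) / lam))) {0..1}"
  proof (rule fundamental_theorem_of_calculus)
    fix t :: real assume "t \<in> {0..1}"
    then show "((\<lambda>t. - ln (s - t) / lam) has_vector_derivative 1 / (lam * (s - t))) (at t within {0..1})"
      using s lam unfolding has_real_derivative_iff_has_vector_derivative[symmetric]
      by (auto intro!: derivative_eq_intros simp: divide_simps)
  qed simp
  then have "integral {0..1} (\<lambda>t. 1 / (lam * (s - t))) = 1 / lam * ln (s / (s - 1))"
    using s by (simp add: integral_unique ln_div diff_divide_distrib)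
  moreover have "finsler_length (funk_metric lam) 0 1 ?c = integral {0..1} (\<lambda>t. 1 / (lam * (s - t)))"
    unfolding finsler_length_def by (rule integral_cong) (rule F)
  ultimately show ?thesis
    by simp
qed

text \<open>
  Let \<open>R = P + s v\<close> be the exit point and \<open>u = \<lambda> R\<close>. Then \<open>1 - \<lambda> \<langle>x,u\<rangle> = \<lambda> \<langle>R - x,u\<rangle>\<close>, and
  \<open>R - P = s v\<close>, \<open>R - (P + v) = (s - 1) v\<close>. So the lower bound belonging to \<open>u\<close> is the length of
  the segment, and the infimum is a minimum.
\<close>

lemma funk_dist_exit_point:
  assumes lam: "lam > 0" and P: "P \<in> Omega lam" and Pv: "P + v \<in> Omega lam" and v: "v \<noteq> 0"
    and s: "s > 1" and exit: "lam * norm (P + s *\<^sub>R v) = 1"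
  shows "finsler_dist (Omega lam) (funk_metric lam) P (P + v) = 1 / lam * ln (s / (s - 1))"
proof -
  let ?L = "{finsler_length (funk_metric lam) a b c | a b c.
    piecewise_regular_curve a b c \<and> c ` {a..b} \<subseteq> Omega lam \<and> c a = P \<and> c b = P + v}"
  define u where "u = lam *\<^sub>R (P + s *\<^sub>R v)"
  have u: "norm u = 1"
    using exit lam by (simp add: u_def)
  then have uu: "u \<bullet> u = 1"
    by (simp add: norm_eq_1)
  have "u \<bullet> u = lam * (P \<bullet> u) + s * (lam * (v \<bullet> u))"
    by (subst (1) u_def) (simp add: inner_add_left algebra_simps)
  then have Pu: "1 - lam * (P \<bullet> u) = s * (lam * (v \<bullet> u))"
    using uu by linarith
  then have Qu: "1 - lam * ((P + v) \<bullet> u) = (s - 1) * (lam * (v \<bullet> u))"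
    by (simp add: inner_add_left algebra_simps)
  have "lam * (v \<bullet> u) \<noteq> 0"
    using Pu inner_unit_less_one[OF lam P u] by auto
  then have ratio: "(1 - lam * (P \<bullet> u)) / (1 - lam * ((P + v) \<bullet> u)) = s / (s - 1)"
    unfolding Pu Qu by simp
  have "1 / lam * ln (s / (s - 1)) \<in> ?L"
  proof -
    have "(\<lambda>t. P + t *\<^sub>R v) ` {0..1} \<subseteq> Omega lam"
      using segment_in_Omega[OF lam P Pv] by auto
    then show ?thesis
      using funk_length_segment[OF lam P Pv s exit] piecewise_regular_segment[OF v, of P]
      by (intro CollectI exI[of _ 0] exI[of _ 1] exI[of _ "\<lambda>t. P + t *\<^sub>R v"]) simp
  qed
  moreover have "1 / lam * ln (s / (s - 1)) \<le> l" if "l \<in> ?L" for l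
    using that funk_length_ge_supporting[OF lam u] ratio by force
  ultimately have "Inf ?L = 1 / lam * ln (s / (s - 1))"
    by (rule cInf_eq_minimum)
  then show ?thesis
    using v by (simp add: finsler_dist_def)
qed

theorem theorem4:
  fixes lam :: real and P Q :: "real^2"
  assumes "lam > 0"
    and "P \<in> Omega lam" and "Q \<in> Omega lam"
  shows "(P \<noteq> Q \<longrightarrow>
      finsler_dist (Omega lam) (funk_metric lam) P Q =
        1 / lam * ln (
          (sqrt (lam\<^sup>2 * (P \<bullet> (Q - P))\<^sup>2 + (1 - lam\<^sup>2 * (norm P)\<^sup>2) * (norm (Q - P))\<^sup>2)
             - lam * (P \<bullet> (Q - P)))
          / (sqrt (lam\<^sup>2 * (P \<bullet> (Q - P))\<^sup>2 + (1 - lam\<^sup>2 * (norm P)\<^sup>2) * (norm (Q - P))\<^sup>2)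
             - lam * (Q \<bullet> (Q - P)))))
    \<and> finsler_dist (Omega lam) (funk_metric lam) P P = 0"
proof (intro conjI impI)
  assume "P \<noteq> Q"
  define v where "v = Q - P"
  define S where "S = sqrt (lam\<^sup>2 * (P \<bullet> v)\<^sup>2 + (1 - lam\<^sup>2 * (norm P)\<^sup>2) * (norm v)\<^sup>2)"
  define s where "s = (S - lam * (P \<bullet> v)) / (lam * (norm v)\<^sup>2)"
  have v: "v \<noteq> 0" and Q: "Q = P + v"
    using \<open>P \<noteq> Q\<close> by (auto simp: v_def)
  have Pv: "P + v \<in> Omega lam"
    using assms(3) Q by simp
  note exit = exit_point[OF assms(1) v assms(2)[unfolded mem_Omega_iff[OF assms(1)]]
      Pv[unfolded mem_Omega_iff[OF assms(1)]], folded S_def, folded s_def]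
  \<comment> \<open>Numerator and denominator in the formula are \<open>s\<close> and \<open>s - 1\<close> times \<open>\<lambda> \<parallel>v\<parallel>\<^sup>2\<close>.\<close>
  have nz: "lam * (norm v)\<^sup>2 \<noteq> 0"
    using assms(1) v by simp
  have "S - lam * (P \<bullet> v) = s * (lam * (norm v)\<^sup>2)"
    using nz by (simp add: s_def)
  moreover from this have "S - lam * (Q \<bullet> v) = (s - 1) * (lam * (norm v)\<^sup>2)"
    by (simp add: Q inner_add_left power2_norm_eq_inner algebra_simps)
  ultimately have "(S - lam * (P \<bullet> v)) / (S - lam * (Q \<bullet> v)) = s / (s - 1)"
    using nz by simp
  then show "finsler_dist (Omega lam) (funk_metric lam) P Q =
      1 / lam * ln (
        (sqrt (lam\<^sup>2 * (P \<bullet> (Q - P))\<^sup>2 + (1 - lam\<^sup>2 * (norm P)\<^sup>2) * (norm (Q - P))\<^sup>2)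
           - lam * (P \<bullet> (Q - P)))
        / (sqrt (lam\<^sup>2 * (P \<bullet> (Q - P))\<^sup>2 + (1 - lam\<^sup>2 * (norm P)\<^sup>2) * (norm (Q - P))\<^sup>2)
           - lam * (Q \<bullet> (Q - P))))"
    using funk_dist_exit_point[OF assms(1,2) Pv v exit]
    unfolding v_def[symmetric] S_def[symmetric] by (simp add: Q)
next
  show "finsler_dist (Omega lam) (funk_metric lam) P P = 0"
    by (simp add: finsler_dist_def)
qed

end
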